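(* Let $t_0\ge 1$. Suppose that $\gamma(t)=\frac{\alpha}{t^r}$ with $r\in(0,1)$ and $\alpha>0$, and $\delta(t)=\frac{t}{2r_0}$ with $r_0>r$. Suppose that $(x(t),y(t),\lambda(t))$ is a global solution of the dynamical system (S) (given in the context) and $(x^*,y^*,\lambda^* )\in\Omega$. Then: (a) $\mathcal{L}(x(t),y(t),\lambda^* )-\mathcal{L}(x^*,y^*,\lambda^* )=\mathcal{O}(t^{-2r})$. (b) $\|Ax(t)+By(t)-b\|=\mathcal{O}(t^{-r})$. (c) $\int_{t_0}^{+\infty}t^{2r-1}\|Ax(t)+By(t)-b\|^2\,dt<+\infty$. (d) $\int_{t_0}^{+\infty}t^r\big(\|\dot x(t)\|^2+\|\dot y(t)\|^2+\|\dot\lambda(t)\|^2\big)\,dt<+\infty$. (e) $\int_{t_0}^{+\infty}t^{2r-1}\big(\mathcal{L}(x(t),y(t),\lambda^* )-\mathcal{L}(x^*,y^*,\lambda^* )\big)\,dt<+\infty$. (f) $\|\dot x(t)\|+\|\dot y(t)\|+\|\dot\lambda(t)\|=\mathcal{O}(t^{-r})$.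
   Context: All spaces are Euclidean with inner product $\langle\cdot,\cdot\rangle$ and norm $\|\cdot\|$. $f:\mathbb{R}^{n_1}\to\mathbb{R}$ and $g:\mathbb{R}^{n_2}\to\mathbb{R}$ are smooth (continuously differentiable) convex functions, $A\in\mathbb{R}^{m\times n_1}$, $B\in\mathbb{R}^{m\times n_2}$, $b\in\mathbb{R}^m$. $\Omega$ is the set of $(x^*,y^*,\lambda^* )\in\mathbb{R}^{n_1}\times\mathbb{R}^{n_2}\times\mathbb{R}^m$ with $-A^T\lambda^*=\nabla f(x^* )$, $-B^T\lambda^*=\nabla g(y^* )$, $Ax^*+By^*-b=0$; it is assumed that $\Omega\neq\emptyset$. The augmented Lagrangian is $$\mathcal{L}(x,y,\lambda)=f(x)+g(y)+\langle\lambda,Ax+By-b\rangle+\tfrac12\|Ax+By-b\|^2.$$ The dynamical system (S) is $$\begin{cases}\ddot{x}(t)+\gamma(t)\dot{x}(t)=-\nabla f(x(t))-A^T(\lambda(t)+\delta(t)\dot\lambda(t))-A^T(Ax(t)+By(t)-b),\\ \ddot{y}(t)+\gamma(t)\dot{y}(t)=-\nabla g(y(t))-B^T(\lambda(t)+\delta(t)\dot\lambda(t))-B^T(Ax(t)+By(t)-b),\\ \ddot{\lambda}(t)+\gamma(t)\dot{\lambda}(t)=A(x(t)+\delta(t)\dot{x}(t))+B(y(t)+\delta(t)\dot{y}(t))-b.\end{cases}$$ A global solution is a triple of $C^2$ functions on $[t_0,+\infty)$ satisfying (S) for all $t\ge t_0$. All $\mathcal{O}(\cdot)$ statements are as $t\to+\infty$.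 *)

theory Defs
  imports "HOL-Analysis.Analysis" "HOL-Library.Landau_Symbols"
begin

definition grad :: "('a::real_inner \<Rightarrow> real) \<Rightarrow> 'a \<Rightarrow> 'a" where
  "grad f x = (THE D. GDERIV f x :> D)"

definition continuously_differentiable :: "('a::real_inner \<Rightarrow> real) \<Rightarrow> bool" where
  "continuously_differentiable f \<longleftrightarrow>
     (\<forall>x. f differentiable (at x)) \<and> continuous_on UNIV (grad f)"

lemma grad_eqI: "GDERIV f x :> D \<Longrightarrow> grad f x = D"
proof -
  assume D: "GDERIV f x :> D"
  show ?thesis
    unfolding grad_def
  proof (rule the_equality)
    show "GDERIV f x :> D" by (rule D)
  next
    fix D' assume "GDERIV f x :> D'"
    then have "(\<lambda>h. inner h D') = (\<lambda>h. inner h D)"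
      using D unfolding gderiv_def by (rule has_derivative_unique)
    then have "\<forall>h. inner h D' = inner h D" by metis
    then show "D' = D" by (metis vector_eq_ldot)
  qed
qed

(* Time derivative on [t0, \<infinity>), one-sided at the endpoint t0. *)
definition tderiv :: "real \<Rightarrow> (real \<Rightarrow> 'a::real_normed_vector) \<Rightarrow> real \<Rightarrow> 'a" where
  "tderiv t0 x t = vector_derivative x (at t within {t0..})"

definition C2_on_ray :: "real \<Rightarrow> (real \<Rightarrow> 'a::real_normed_vector) \<Rightarrow> bool" where
  "C2_on_ray t0 x \<longleftrightarrow>
     x differentiable_on {t0..} \<and>
     tderiv t0 x differentiable_on {t0..} \<and>
     continuous_on {t0..} (tderiv t0 (tderiv t0 x))"

definition KKT_set ::
  "(real^'n1 \<Rightarrow> real) \<Rightarrow> (real^'n2 \<Rightarrow> real) \<Rightarrow> real^'n1^'m \<Rightarrow> real^'n2^'m \<Rightarrow> real^'m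
    \<Rightarrow> ((real^'n1) \<times> (real^'n2) \<times> (real^'m)) set" where
  "KKT_set f g A B b =
     {(xs, ys, ls). - (transpose A *v ls) = grad f xs \<and>
                    - (transpose B *v ls) = grad g ys \<and>
                    A *v xs + B *v ys - b = 0}"

definition aug_lagrangian ::
  "(real^'n1 \<Rightarrow> real) \<Rightarrow> (real^'n2 \<Rightarrow> real) \<Rightarrow> real^'n1^'m \<Rightarrow> real^'n2^'m \<Rightarrow> real^'m
    \<Rightarrow> real^'n1 \<Rightarrow> real^'n2 \<Rightarrow> real^'m \<Rightarrow> real" where
  "aug_lagrangian f g A B b x y l =
     f x + g y + l \<bullet> (A *v x + B *v y - b) + 1/2 * (norm (A *v x + B *v y - b))\<^sup>2"

definition global_solution ::
  "(real^'n1 \<Rightarrow> real) \<Rightarrow> (real^'n2 \<Rightarrow> real) \<Rightarrow> real^'n1^'m \<Rightarrow> real^'n2^'m \<Rightarrow> real^'m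
    \<Rightarrow> (real \<Rightarrow> real) \<Rightarrow> (real \<Rightarrow> real) \<Rightarrow> real
    \<Rightarrow> (real \<Rightarrow> real^'n1) \<Rightarrow> (real \<Rightarrow> real^'n2) \<Rightarrow> (real \<Rightarrow> real^'m) \<Rightarrow> bool" where
  "global_solution f g A B b \<gamma> \<delta> t0 x y l \<longleftrightarrow>
     C2_on_ray t0 x \<and> C2_on_ray t0 y \<and> C2_on_ray t0 l \<and>
     (\<forall>t\<ge>t0.
        tderiv t0 (tderiv t0 x) t + \<gamma> t *\<^sub>R tderiv t0 x t =
          - grad f (x t) - transpose A *v (l t + \<delta> t *\<^sub>R tderiv t0 l t)
          - transpose A *v (A *v x t + B *v y t - b) \<and>
        tderiv t0 (tderiv t0 y) t + \<gamma> t *\<^sub>R tderiv t0 y t =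
          - grad g (y t) - transpose B *v (l t + \<delta> t *\<^sub>R tderiv t0 l t)
          - transpose B *v (A *v x t + B *v y t - b) \<and>
        tderiv t0 (tderiv t0 l) t + \<gamma> t *\<^sub>R tderiv t0 l t =
          A *v (x t + \<delta> t *\<^sub>R tderiv t0 x t) + B *v (y t + \<delta> t *\<^sub>R tderiv t0 y t) - b)"

end

theory Submission
  imports Defs
begin

text \<open>
  Write \<open>z = (x - xs, y - ys, l - ls)\<close> for the displacement from the KKT point,
  \<open>\<Phi>\<close> for the Lagrangian gap along the trajectory and \<open>h = A x + B y - b\<close> for the residual.
  The system then reads \<open>z'' + (\<alpha> / t\<^sup>r) z' + G = 0\<close>, and two facts about it suffice.

  First, the coupling between the primal and the dual variables is skew-symmetric. All
  three equations are evaluated at the same extrapolation \<open>z + \<delta> z'\<close>, so the coupling vanishes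
  when \<open>G\<close> is tested against \<open>z + \<delta> z'\<close>. What remains is a gradient, and convexity bounds
  it: \<open>\<langle>z + \<delta> z', G\<rangle> \<ge> \<Phi> + |h|\<^sup>2 / 2 + \<delta> \<Phi>'\<close> (lemma \<open>gap_along_extrapolation\<close>).

  Second, with \<open>\<delta> = t / (2 r0)\<close> and \<open>p = t\<^sup>r\<^sup>-\<^sup>1\<close>, the vector \<open>2 r0 p z + t\<^sup>r z'\<close> is \<open>2 r0 p\<close> times
  that extrapolation. In the Lyapunov function
  \<open>E = t\<^sup>2\<^sup>r \<Phi> + |2 r0 p z + t\<^sup>r z'|\<^sup>2 / 2 + r0 p (\<alpha> - (2 r0 + 2 r - 1) p) |z|\<^sup>2\<close>
  the terms in \<open>\<Phi>'\<close> therefore cancel, and the coefficient of \<open>|z|\<^sup>2\<close> is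
  the one that also cancels \<open>\<langle>z, z'\<rangle>\<close>. Since \<open>r < 1\<close>, \<open>p\<close> tends to \<open>0\<close>, and for large \<open>t\<close>
  the damping dominates all remaining terms of the wrong sign:
  \<open>E' \<le> - 2 (r0 - r) t\<^sup>2\<^sup>r\<^sup>-\<^sup>1 \<Phi> - r0 t\<^sup>2\<^sup>r\<^sup>-\<^sup>1 |h|\<^sup>2 - (\<alpha> / 2) t\<^sup>r |z'|\<^sup>2\<close> (lemma \<open>energy_dissipation\<close>).

  As \<open>E\<close> is eventually nonnegative and nonincreasing, integrating this inequality gives the three
  integral estimates, and boundedness of each summand of \<open>E\<close> gives the rates. The rate of the
  residual follows from \<open>|h|\<^sup>2 \<le> 2 \<Phi>\<close>. For the velocities, \<open>p |z|\<^sup>2\<close> is bounded and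
  \<open>p \<le> 1\<close>, so \<open>p |z|\<close> is bounded, and hence so is \<open>t\<^sup>r z'\<close>.
\<close>

section \<open>Integrability from a dissipation inequality\<close>

text \<open>
  Past \<open>T\<close>, the integral of \<open>c * q\<close> is paid for by the decrease of \<open>E\<close>, which cannot exceed \<open>E T\<close>;
  on \<open>{a..T}\<close> continuity suffices.
\<close>
lemma energy_dissipation_imp_set_integrable:
  fixes E E' q :: "real \<Rightarrow> real"
  assumes cont: "continuous_on {a..} q" and nonneg: "\<And>t. t \<ge> a \<Longrightarrow> q t \<ge> 0"
    and "a \<le> T"
    and E: "\<And>t. t \<ge> T \<Longrightarrow> (E has_real_derivative E' t) (at t)"
    and E_nonneg: "\<And>t. t \<ge> T \<Longrightarrow> E t \<ge> 0"
    and "c > 0" and dissipation: "\<And>t. t \<ge> T \<Longrightarrow> E' t \<le> - c * q t"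
  shows "set_integrable lborel {a..} q"
proof -
  have cont_Icc: "continuous_on {u..v} q" if "a \<le> u" for u v
    using cont by (rule continuous_on_subset) (use that in auto)
  have integrable_Icc: "q integrable_on {u..v}" if "a \<le> u" for u v
    using cont_Icc[OF that] by (rule integrable_continuous_real)
  define K where "K = integral {a..T} q + E T / c"
  have bound: "integral {a..s} q \<le> K" for s
  proof (cases "T \<le> s")
    case True
    let ?D = "\<lambda>t. E t + c * integral {T..t} q"
    have "?D s \<le> ?D T"
    proof (rule DERIV_nonpos_imp_decreasing_open[OF True])
      fix t assume t: "T < t" "t < s"
      have "((\<lambda>u. integral {T..u} q) has_real_derivative q t) (at t within {T..s})"
        using t \<open>a \<le> T\<close> by (intro integral_has_real_derivative cont_Icc) auto
      moreover have "at t within {T..s} = at t"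
        using t by (intro at_within_interior) (auto simp: interior_atLeastAtMost_real)
      ultimately have "(?D has_real_derivative E' t + c * q t) (at t)"
        using E[of t] t by (auto intro!: derivative_eq_intros)
      then show "\<exists>y. (?D has_real_derivative y) (at t) \<and> y \<le> 0"
        using dissipation[of t] t by auto
    next
      have "continuous_on {T..s} E"
        using E by (intro continuous_at_imp_continuous_on) (meson DERIV_isCont atLeastAtMost_iff)
      then show "continuous_on {T..s} ?D"
        using integrable_Icc[OF \<open>a \<le> T\<close>]
        by (intro continuous_intros indefinite_integral_continuous_1) auto
    qed
    then have "c * integral {T..s} q \<le> E T"
      using E_nonneg[OF True] by simp
    then have "integral {T..s} q \<le> E T / c"
      using \<open>c > 0\<close> by (simp add: field_simps)
    moreover have "integral {a..s} q = integral {a..T} q + integral {T..s} q"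
      using True \<open>a \<le> T\<close>
        Henstock_Kurzweil_Integration.integral_combine[of a T s q] integrable_Icc[of a s] by simp
    ultimately show ?thesis by (simp add: K_def)
  next
    case False
    then have "integral {a..s} q \<le> integral {a..T} q"
      using integrable_Icc nonneg by (intro integral_subset_le) auto
    then show ?thesis
      using E_nonneg[of T] \<open>c > 0\<close> by (simp add: K_def add_increasing2)
  qed
  \<comment> \<open>Monotone convergence along the truncations of \<open>q\<close>.\<close>
  define qk where "qk k t = (if t \<in> {a..a + real k} then q t else 0)" for k t
  have qk_integrable: "qk k integrable_on {a..}" for k
    unfolding qk_def using integrable_Icc[of a "a + real k"]
    by (subst integrable_restrict_Int) (simp add: Int_absorb1 Icc_subset_Ici_iff)
  have qk_integral: "integral {a..} (qk k) = integral {a..a + real k} q" for k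
    unfolding qk_def by (subst integral_restrict_Int) (simp add: Int_absorb1 Icc_subset_Ici_iff)
  have "q integrable_on {a..} \<and> (\<lambda>k. integral {a..} (qk k)) \<longlonglongrightarrow> integral {a..} q"
  proof (rule monotone_convergence_increasing[OF qk_integrable])
    fix k t assume "t \<in> {a..}"
    then show "qk k t \<le> qk (Suc k) t"
      using nonneg by (auto simp: qk_def)
  next
    fix t assume "t \<in> {a..}"
    then have "\<forall>\<^sub>F k in sequentially. qk k t = q t"
      by (intro eventually_sequentiallyI[of "nat \<lceil>t - a\<rceil>"]) (auto simp: qk_def; linarith)
    then show "(\<lambda>k. qk k t) \<longlonglongrightarrow> q t"
      by (rule tendsto_eventually)
  next
    have "0 \<le> integral {a..a + real k} q" for k
      using integrable_Icc nonneg by (intro Henstock_Kurzweil_Integration.integral_nonneg) auto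
    then show "bounded (range (\<lambda>k. integral {a..} (qk k)))"
      using bound unfolding qk_integral by (intro boundedI[of _ K]) auto
  qed
  then have "q absolutely_integrable_on {a..}"
    using nonneg by (intro nonnegative_absolutely_integrable_1) auto
  moreover have "(\<lambda>t. indicator {a..} t *\<^sub>R q t) \<in> borel_measurable lborel"
    using borel_measurable_continuous_on_indicator[OF _ cont] by simp
  ultimately show ?thesis
    unfolding set_integrable_def by (simp add: integrable_completion)
qed

section \<open>Gradients of differentiable convex functions\<close>

text \<open>The gradient exists by Riesz representation: it is the adjoint of the derivative at \<open>1\<close>.\<close>
lemma gderiv_grad:
  fixes f :: "'a::euclidean_space \<Rightarrow> real"
  assumes "f differentiable (at x)"
  shows "GDERIV f x :> grad f x"
proof -
  obtain f' where f': "(f has_derivative f') (at x)"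
    using assms by (auto simp: differentiable_def)
  then have "f' = (\<lambda>h. h \<bullet> adjoint f' 1)"
    by (subst adjoint_works) (auto simp: has_derivative_linear)
  with f' have "GDERIV f x :> adjoint f' 1"
    by (simp add: gderiv_def)
  with grad_eqI[OF this] show ?thesis
    by simp
qed

lemma has_derivative_grad:
  fixes f :: "'a::euclidean_space \<Rightarrow> real"
  assumes "continuously_differentiable f"
  shows "(f has_derivative (\<lambda>h. h \<bullet> grad f x)) (at x)"
  using gderiv_grad[of f x] assms by (simp add: continuously_differentiable_def gderiv_def)

text \<open>Restricting \<open>f\<close> to the line through \<open>u\<close> and \<open>v\<close> reduces this to the tangent inequality on the
  real line.\<close>
lemma convex_gradient_inequality:
  fixes f :: "'a::euclidean_space \<Rightarrow> real"
  assumes "continuously_differentiable f" and "convex_on UNIV f"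
  shows "f v - f u \<ge> grad f u \<bullet> (v - u)"
proof -
  let ?\<phi> = "\<lambda>s::real. f (u + s *\<^sub>R (v - u))"
  have "convex_on UNIV ?\<phi>"
  proof (rule convex_onI)
    fix t a c :: real assume t: "0 < t" "t < 1"
    have "u + ((1 - t) *\<^sub>R a + t *\<^sub>R c) *\<^sub>R (v - u)
      = (1 - t) *\<^sub>R (u + a *\<^sub>R (v - u)) + t *\<^sub>R (u + c *\<^sub>R (v - u))"
      by (simp add: algebra_simps)
    then show "?\<phi> ((1 - t) *\<^sub>R a + t *\<^sub>R c) \<le> (1 - t) * ?\<phi> a + t * ?\<phi> c"
      using convex_onD[OF assms(2), of t] t by simp
  qed auto
  moreover have "(?\<phi> has_real_derivative grad f u \<bullet> (v - u)) (at 0)"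
  proof -
    have "((\<lambda>s::real. u + s *\<^sub>R (v - u)) has_derivative (\<lambda>s. s *\<^sub>R (v - u))) (at 0)"
      by (auto intro!: derivative_eq_intros)
    then have "(?\<phi> has_derivative (\<lambda>s. (s *\<^sub>R (v - u)) \<bullet> grad f u)) (at 0)"
      by (rule has_derivative_compose[OF _ has_derivative_grad[OF assms(1), THEN has_derivative_eq_rhs]])
         simp
    then show ?thesis
      by (simp add: has_field_derivative_def inner_commute mult.commute mult_commute_abs)
  qed
  ultimately show ?thesis
    using convex_on_imp_above_tangent[of UNIV ?\<phi> 0 1] by simp
qed

section \<open>Inertial systems with vanishing damping and a gap function\<close>

text \<open>
  The locale keeps of the primal-dual system only what the energy argument uses. The force
  \<open>G\<close> may depend on time and velocity in any way, and the assumption \<open>extrapolated_gap\<close>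
  replaces the gradient structure and the convexity. Derivatives at \<open>t0\<close> are one-sided.
\<close>
locale damped_inertial_system =
  fixes z z' G :: "real \<Rightarrow> 'h::real_inner" and \<Phi> \<Phi>' H :: "real \<Rightarrow> real"
    and t0 r \<alpha> r0 :: real
  assumes t0: "t0 \<ge> 1" and r_pos: "0 < r" and r_less: "r < 1"
    and \<alpha>_pos: "\<alpha> > 0" and r0: "r0 > r"
    and z_deriv: "\<And>t. t \<ge> t0 \<Longrightarrow> (z has_vector_derivative z' t) (at t within {t0..})"
    and z'_deriv: "\<And>t. t \<ge> t0 \<Longrightarrow>
      (z' has_vector_derivative - (\<alpha> / t powr r) *\<^sub>R z' t - G t) (at t within {t0..})"
    and \<Phi>_deriv: "\<And>t. t \<ge> t0 \<Longrightarrow> (\<Phi> has_real_derivative \<Phi>' t) (at t within {t0..})"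
    and H_cont: "continuous_on {t0..} H"
    and H_nonneg: "\<And>t. t \<ge> t0 \<Longrightarrow> 0 \<le> H t"
    and \<Phi>_nonneg: "\<And>t. t \<ge> t0 \<Longrightarrow> 0 \<le> \<Phi> t"
    and extrapolated_gap: "\<And>t. t \<ge> t0 \<Longrightarrow>
      \<Phi> t + H t / 2 + t / (2 * r0) * \<Phi>' t \<le> (z t + (t / (2 * r0)) *\<^sub>R z' t) \<bullet> G t"
begin

definition energy :: "real \<Rightarrow> real" where
  "energy t = (let p = t powr (r - 1) in
     (t * p)\<^sup>2 * \<Phi> t + 1/2 * (norm ((2 * r0 * p) *\<^sub>R z t + (t * p) *\<^sub>R z' t))\<^sup>2
     + r0 * p * (\<alpha> - (2 * r0 + 2 * r - 1) * p) * (norm (z t))\<^sup>2)"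

text \<open>
  The factor 4 serves three purposes at once: it makes the weight of \<open>|z|\<^sup>2\<close> in the energy at least
  \<open>r0 p \<alpha> / 2\<close>, it makes the coefficient of \<open>|z|\<^sup>2\<close> in the derivative of
  the energy nonpositive, and it leaves at least half of the damping of \<open>|z'|\<^sup>2\<close>. Starting strictly after
  \<open>t0\<close> makes all derivatives two-sided.
\<close>
definition damping_dominates :: "real \<Rightarrow> bool" where
  "damping_dominates T \<longleftrightarrow> t0 < T \<and> (\<forall>t\<ge>T. 4 * (r0 + r) * t powr (r - 1) \<le> \<alpha>)"

lemma r0_pos: "r0 > 0"
  using r0 r_pos by simp

lemma damping_dominates_eventually: "\<exists>T. damping_dominates T"
proof -
  have "((\<lambda>t. 4 * (r0 + r) * t powr (r - 1)) \<longlongrightarrow> 4 * (r0 + r) * 0) at_top"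
    using r_less by (intro tendsto_intros tendsto_neg_powr filterlim_ident) auto
  then have "\<forall>\<^sub>F t in at_top. 4 * (r0 + r) * t powr (r - 1) < \<alpha>"
    using \<alpha>_pos by (intro order_tendstoD) auto
  then have "\<forall>\<^sub>F t in at_top. t0 < t \<and> 4 * (r0 + r) * t powr (r - 1) < \<alpha>"
    by (intro eventually_conj eventually_gt_at_top)
  then show ?thesis
    unfolding damping_dominates_def eventually_at_top_linorder by (meson less_imp_le order_refl)
qed

lemma powr_as_product:
  assumes "t \<ge> t0"
  shows "t powr r = t * t powr (r - 1)" and "t powr (2 * r) = (t * t powr (r - 1))\<^sup>2"
    and "t powr (2 * r - 1) = t * (t powr (r - 1))\<^sup>2"
proof -
  have t: "t > 0" using assms t0 by simp
  show 1: "t powr r = t * t powr (r - 1)"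
    using t by (simp add: powr_diff)
  show "t powr (2 * r) = (t * t powr (r - 1))\<^sup>2"
    unfolding 1[symmetric] by (simp add: power2_eq_square flip: powr_add)
  show "t powr (2 * r - 1) = t * (t powr (r - 1))\<^sup>2"
    using t by (simp add: power2_eq_square powr_diff field_simps flip: powr_add)
qed

text \<open>
  The scalars stand for \<open>N = |z|\<^sup>2\<close>, \<open>M = \<langle>z, z'\<rangle>\<close>, \<open>W = |z'|\<^sup>2\<close>, \<open>S = \<langle>z, G\<rangle>\<close>, \<open>R = \<langle>z', G\<rangle>\<close>, and
  \<open>F\<close>, \<open>F'\<close> for the gap and its derivative. The left-hand side is the derivative of the energy
  term by term. On the right \<open>M\<close> has disappeared: its coefficient is
  \<open>2 r0 p\<^sup>2 (2 r0 + 2 r - 1 - k)\<close>, which dictates the choice of \<open>k\<close>.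
\<close>
lemma cross_term_free_energy_derivative:
  fixes t p \<gamma> N M W S R F F' :: real
  assumes "t > 0" and "\<gamma> * (t * p) = \<alpha>"
  defines "p' \<equiv> (r - 1) * p / t" and "k \<equiv> 2 * r0 + 2 * r - 1"
  shows "2 * r * t * p\<^sup>2 * F + (t * p)\<^sup>2 * F'
      + 4 * r0\<^sup>2 * p * p' * N + 4 * r0\<^sup>2 * p\<^sup>2 * M
      + 2 * r0 * (p\<^sup>2 + 2 * t * p * p') * M + 2 * r0 * t * p\<^sup>2 * (W - \<gamma> * M - S)
      + (t * p\<^sup>2 + t\<^sup>2 * p * p') * W - (t * p)\<^sup>2 * (\<gamma> * W + R)
      + r0 * (\<alpha> - 2 * k * p) * p' * N + 2 * r0 * p * (\<alpha> - k * p) * M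
    = 2 * r * t * p\<^sup>2 * F - 2 * r0 * t * p\<^sup>2 * (S + t / (2 * r0) * (R - F'))
      - r0 * (1 - r) * p / t * (\<alpha> + (2 - 4 * r) * p) * N
      + (2 * r0 + r) * t * p\<^sup>2 * W - \<alpha> * t * p * W"
  using assms(1) r0_pos unfolding assms(2)[symmetric] p'_def k_def
  by (simp add: divide_simps) (simp add: algebra_simps power2_eq_square)

lemma energy_expand:
  "energy t = (t * t powr (r - 1))\<^sup>2 * \<Phi> t + 2 * r0\<^sup>2 * (t powr (r - 1))\<^sup>2 * (z t \<bullet> z t)
    + 2 * r0 * t * (t powr (r - 1))\<^sup>2 * (z t \<bullet> z' t)
    + 1/2 * (t * t powr (r - 1))\<^sup>2 * (z' t \<bullet> z' t)
    + r0 * (t powr (r - 1)) * (\<alpha> - (2 * r0 + 2 * r - 1) * t powr (r - 1)) * (z t \<bullet> z t)"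
  unfolding energy_def Let_def power2_norm_eq_inner
  by (simp add: inner_simps inner_commute power2_eq_square algebra_simps)

text \<open>
  The gap inequality, multiplied by \<open>2 r0 t p\<^sup>2\<close>, turns the growth \<open>2 r t p\<^sup>2 \<Phi>\<close> of the weight
  \<open>t\<^sup>2\<^sup>r\<close> into the decay \<open>2 (r - r0) t p\<^sup>2 \<Phi>\<close>; this is where \<open>r0 > r\<close> enters.
\<close>
lemma energy_dissipation:
  assumes "damping_dominates T" and "t \<ge> T"
  shows "\<exists>D. (energy has_real_derivative D) (at t) \<and>
    D \<le> - 2 * (r0 - r) * (t powr (2 * r - 1) * \<Phi> t) - r0 * (t powr (2 * r - 1) * H t)
        - \<alpha> / 2 * (t powr r * (norm (z' t))\<^sup>2)"
proof -
  define p where "p = t powr (r - 1)"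
  define p' where "p' = (r - 1) * p / t"
  define k where "k = 2 * r0 + 2 * r - 1"
  define \<gamma> where "\<gamma> = \<alpha> / t powr r"
  define N M W S R where "N = z t \<bullet> z t" and "M = z t \<bullet> z' t" and "W = z' t \<bullet> z' t"
    and "S = z t \<bullet> G t" and "R = z' t \<bullet> G t"
  have t: "t > t0" "t > 0" and damped: "4 * (r0 + r) * p \<le> \<alpha>"
    using assms t0 by (auto simp: damping_dominates_def p_def)
  have p: "p > 0" using t by (simp add: p_def)
  have interior: "at t within {t0..} = at t"
    using t by (intro at_within_interior) (auto simp: interior_real_atLeast)
  have dz: "(z has_vector_derivative z' t) (at t)"
    and dz': "(z' has_vector_derivative - \<gamma> *\<^sub>R z' t - G t) (at t)"
    and d\<Phi>: "(\<Phi> has_real_derivative \<Phi>' t) (at t)"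
    using z_deriv[of t] z'_deriv[of t] \<Phi>_deriv[of t] t unfolding interior \<gamma>_def by auto
  have dinner: "((\<lambda>s. u s \<bullet> v s) has_real_derivative u t \<bullet> v' + u' \<bullet> v t) (at t)"
    if "(u has_vector_derivative u') (at t)" "(v has_vector_derivative v') (at t)"
    for u v :: "real \<Rightarrow> 'h" and u' v'
  proof -
    have "((\<lambda>s. u s \<bullet> v s) has_derivative (\<lambda>h. u t \<bullet> (h *\<^sub>R v') + (h *\<^sub>R u') \<bullet> v t)) (at t)"
      using that unfolding has_vector_derivative_def by (rule has_derivative_inner)
    then show ?thesis
      unfolding has_field_derivative_def by (rule has_derivative_eq_rhs) (simp add: fun_eq_iff algebra_simps)
  qed
  have dN: "((\<lambda>s. z s \<bullet> z s) has_real_derivative 2 * M) (at t)"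
    using dinner[OF dz dz] by (simp add: M_def inner_commute)
  have dM: "((\<lambda>s. z s \<bullet> z' s) has_real_derivative W - \<gamma> * M - S) (at t)"
    using dinner[OF dz dz'] by (simp add: M_def W_def S_def inner_simps algebra_simps)
  have dW: "((\<lambda>s. z' s \<bullet> z' s) has_real_derivative - 2 * (\<gamma> * W + R)) (at t)"
    using dinner[OF dz' dz'] by (simp add: W_def R_def inner_simps inner_commute)
  have dp: "((\<lambda>s. s powr (r - 1)) has_real_derivative p') (at t)"
    using has_real_derivative_powr[of t "r - 1"] t by (simp add: p'_def p_def powr_diff power2_eq_square)
  define D where "D = 2 * r * t * p\<^sup>2 * \<Phi> t + (t * p)\<^sup>2 * \<Phi>' t
      + 4 * r0\<^sup>2 * p * p' * N + 4 * r0\<^sup>2 * p\<^sup>2 * M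
      + 2 * r0 * (p\<^sup>2 + 2 * t * p * p') * M + 2 * r0 * t * p\<^sup>2 * (W - \<gamma> * M - S)
      + (t * p\<^sup>2 + t\<^sup>2 * p * p') * W - (t * p)\<^sup>2 * (\<gamma> * W + R)
      + r0 * (\<alpha> - 2 * k * p) * p' * N + 2 * r0 * p * (\<alpha> - k * p) * M"
  have p'_t: "p + t * p' = r * p"
    using t by (simp add: p'_def field_simps)
  have dgap: "((\<lambda>t. (t * t powr (r - 1))\<^sup>2 * \<Phi> t) has_real_derivative
      2 * r * t * p\<^sup>2 * \<Phi> t + (t * p)\<^sup>2 * \<Phi>' t) (at t)"
  proof -
    have "((\<lambda>t. (t * t powr (r - 1))\<^sup>2 * \<Phi> t) has_real_derivative
        2 * (t * p) * (p + t * p') * \<Phi> t + (t * p)\<^sup>2 * \<Phi>' t) (at t)"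
      by (rule dp d\<Phi> derivative_eq_intros refl)+ (simp add: p_def[symmetric] algebra_simps)
    then show ?thesis
      unfolding p'_t by (simp add: power2_eq_square algebra_simps)
  qed
  have "(energy has_real_derivative D) (at t)"
    unfolding energy_expand[abs_def] D_def
    by (rule dgap dp dN dM dW derivative_eq_intros refl)+
       (simp add: p_def[symmetric] N_def[symmetric] M_def[symmetric] W_def[symmetric] k_def
         power2_eq_square algebra_simps)
  moreover have "D \<le> - 2 * (r0 - r) * (t * p\<^sup>2 * \<Phi> t) - r0 * (t * p\<^sup>2 * H t) - \<alpha> / 2 * (t * p * W)"
  proof -
    have \<gamma>_tp: "\<gamma> * (t * p) = \<alpha>"
      using t powr_as_product(1)[of t] by (simp add: \<gamma>_def p_def)
    have D_eq: "D = 2 * r * t * p\<^sup>2 * \<Phi> t - 2 * r0 * t * p\<^sup>2 * (S + t / (2 * r0) * (R - \<Phi>' t))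
      - r0 * (1 - r) * p / t * (\<alpha> + (2 - 4 * r) * p) * N
      + (2 * r0 + r) * t * p\<^sup>2 * W - \<alpha> * t * p * W"
      unfolding D_def p'_def k_def by (rule cross_term_free_energy_derivative[OF t(2) \<gamma>_tp])
    have "\<Phi> t + H t / 2 \<le> S + t / (2 * r0) * (R - \<Phi>' t)"
      using extrapolated_gap[of t] t by (simp add: S_def R_def inner_simps algebra_simps)
    then have gap: "2 * r0 * t * p\<^sup>2 * (\<Phi> t + H t / 2)
        \<le> 2 * r0 * t * p\<^sup>2 * (S + t / (2 * r0) * (R - \<Phi>' t))"
      using r0_pos t p by (intro mult_left_mono) auto
    have "4 * r * p \<le> 4 * (r0 + r) * p"
      using r0_pos p by (simp add: algebra_simps)
    then have "0 \<le> \<alpha> + (2 - 4 * r) * p"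
      using damped p by (simp add: algebra_simps)
    then have N: "0 \<le> r0 * (1 - r) * p / t * (\<alpha> + (2 - 4 * r) * p) * N"
      using r0_pos r_less p t by (simp add: N_def)
    have "2 * (2 * r0 + r) * p \<le> 4 * (r0 + r) * p"
      using r_pos p by (simp add: algebra_simps)
    then have "(2 * r0 + r) * p \<le> \<alpha> / 2"
      using damped by linarith
    then have "(2 * r0 + r) * p * (t * p * W) \<le> \<alpha> / 2 * (t * p * W)"
      using p t by (intro mult_right_mono) (auto simp: W_def)
    then have "(2 * r0 + r) * t * p\<^sup>2 * W - \<alpha> * t * p * W \<le> - \<alpha> / 2 * (t * p * W)"
      by (simp add: power2_eq_square algebra_simps)
    with gap N show ?thesis
      unfolding D_eq by (simp add: algebra_simps)
  qed
  ultimately show ?thesis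
    using t powr_as_product[of t] by (auto simp: p_def W_def power2_norm_eq_inner)
qed

lemma energy_coercive:
  assumes "damping_dominates T" and "t \<ge> T"
  shows "t powr (2 * r) * \<Phi> t + 1/2 * (norm ((2 * r0 * t powr (r - 1)) *\<^sub>R z t + t powr r *\<^sub>R z' t))\<^sup>2
      + r0 * \<alpha> / 2 * (t powr (r - 1) * (norm (z t))\<^sup>2) \<le> energy t"
proof -
  define p where "p = t powr (r - 1)"
  have t: "t \<ge> t0" and damped: "4 * (r0 + r) * p \<le> \<alpha>"
    using assms by (auto simp: damping_dominates_def p_def)
  have p: "0 \<le> p" by (simp add: p_def)
  have "\<alpha> / 2 \<le> \<alpha> - (2 * r0 + 2 * r - 1) * p"
    using damped p by (simp add: algebra_simps)
  then have "r0 * p * (\<alpha> / 2) * (norm (z t))\<^sup>2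
      \<le> r0 * p * (\<alpha> - (2 * r0 + 2 * r - 1) * p) * (norm (z t))\<^sup>2"
    using r0_pos p by (intro mult_right_mono mult_left_mono) auto
  then show ?thesis
    unfolding energy_def Let_def p_def[symmetric] powr_as_product[OF t, folded p_def]
    by (simp add: algebra_simps)
qed

lemma energy_nonneg: "damping_dominates T \<Longrightarrow> t \<ge> T \<Longrightarrow> 0 \<le> energy t"
  using energy_coercive[of T t] \<Phi>_nonneg[of t] r0_pos \<alpha>_pos
  by (intro order_trans[OF _ energy_coercive] add_nonneg_nonneg mult_nonneg_nonneg)
     (auto simp: damping_dominates_def)

lemma dissipated_nonneg:
  assumes "t \<ge> t0"
  shows "0 \<le> t powr (2 * r - 1) * \<Phi> t" and "0 \<le> t powr (2 * r - 1) * H t"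
    and "0 \<le> t powr r * (norm (z' t))\<^sup>2"
  using H_nonneg[OF assms] \<Phi>_nonneg[OF assms] by auto

lemma energy_antimono:
  assumes "damping_dominates T" and "t \<ge> T"
  shows "energy t \<le> energy T"
proof (rule DERIV_nonpos_imp_nonincreasing[OF \<open>t \<ge> T\<close>])
  fix s assume s: "T \<le> s" "s \<le> t"
  then have "s \<ge> t0" using \<open>damping_dominates T\<close> by (simp add: damping_dominates_def)
  have "- 2 * (r0 - r) * (s powr (2 * r - 1) * \<Phi> s) - r0 * (s powr (2 * r - 1) * H s)
        - \<alpha> / 2 * (s powr r * (norm (z' s))\<^sup>2) \<le> 0"
    using dissipated_nonneg[OF \<open>s \<ge> t0\<close>] r0 r0_pos \<alpha>_pos
    by (smt (verit) mult_nonneg_nonneg half_gt_zero mult_minus_left)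
  then show "\<exists>D. (energy has_real_derivative D) (at s) \<and> D \<le> 0"
    using energy_dissipation[OF \<open>damping_dominates T\<close> \<open>T \<le> s\<close>] order_trans by blast
qed

text \<open>
  The energy controls \<open>2 r0 p z + t\<^sup>r z'\<close> and not \<open>t\<^sup>r z'\<close> itself. No bound on the
  displacement is at hand, but \<open>(p |z|)\<^sup>2 \<le> p |z|\<^sup>2\<close> because \<open>p \<le> 1\<close>, and the last summand of the energy
  bounds the right-hand side.
\<close>
lemma gap_and_velocity_bounds:
  "\<exists>T C. t0 < T \<and> (\<forall>t\<ge>T. t powr (2 * r) * \<Phi> t \<le> C \<and> t powr r * norm (z' t) \<le> C)"
proof -
  obtain T where T: "damping_dominates T" using damping_dominates_eventually by blast
  define C where "C = energy T"
  define V where "V = sqrt (2 * C) + 2 * r0 * sqrt (2 * C / (r0 * \<alpha>))"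
  have "t powr (2 * r) * \<Phi> t \<le> C \<and> t powr r * norm (z' t) \<le> V" if t: "t \<ge> T" for t
  proof -
    let ?p = "t powr (r - 1)" and ?v = "(2 * r0 * t powr (r - 1)) *\<^sub>R z t + t powr r *\<^sub>R z' t"
    have "t \<ge> t0" using T t by (simp add: damping_dominates_def)
    have p: "?p \<le> 1"
      using \<open>t \<ge> t0\<close> t0 r_less powr_mono[of "r - 1" 0 t] by simp
    have total: "t powr (2 * r) * \<Phi> t + 1/2 * (norm ?v)\<^sup>2
        + r0 * \<alpha> / 2 * (?p * (norm (z t))\<^sup>2) \<le> C"
      using energy_coercive[OF T t] energy_antimono[OF T t] by (simp add: C_def)
    have parts: "0 \<le> t powr (2 * r) * \<Phi> t" "0 \<le> 1/2 * (norm ?v)\<^sup>2"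
        "0 \<le> r0 * \<alpha> / 2 * (?p * (norm (z t))\<^sup>2)"
      using \<Phi>_nonneg[OF \<open>t \<ge> t0\<close>] r0_pos \<alpha>_pos by auto
    have v: "norm ?v \<le> sqrt (2 * C)"
      using total parts by (intro real_le_rsqrt) simp
    have "(?p * norm (z t))\<^sup>2 = ?p * (?p * (norm (z t))\<^sup>2)"
      by (simp add: power2_eq_square)
    also have "\<dots> \<le> 1 * (?p * (norm (z t))\<^sup>2)"
      using p by (intro mult_right_mono) auto
    also have "\<dots> \<le> 2 * C / (r0 * \<alpha>)"
    proof -
      have "r0 * \<alpha> / 2 * (?p * (norm (z t))\<^sup>2) \<le> C"
        using total parts(1,2) by linarith
      then show ?thesis
        using r0_pos \<alpha>_pos by (simp add: pos_le_divide_eq mult.commute)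
    qed
    finally have z: "?p * norm (z t) \<le> sqrt (2 * C / (r0 * \<alpha>))"
      by (rule real_le_rsqrt)
    have "t powr r * norm (z' t) = norm (?v - (2 * r0 * ?p) *\<^sub>R z t)"
      by simp
    also have "\<dots> \<le> norm ?v + norm ((2 * r0 * ?p) *\<^sub>R z t)"
      by (rule norm_triangle_ineq4)
    also have "\<dots> = norm ?v + 2 * r0 * (?p * norm (z t))"
      using r0_pos by simp
    also have "\<dots> \<le> V"
      unfolding V_def using v z r0_pos by (intro add_mono mult_left_mono) auto
    finally have "t powr r * norm (z' t) \<le> V" .
    moreover have "t powr (2 * r) * \<Phi> t \<le> C"
      using total parts(2,3) by linarith
    ultimately show ?thesis by blast
  qed
  then show ?thesis
    using T unfolding damping_dominates_def by (intro exI[of _ T] exI[of _ "max C V"]) (auto simp: le_max_iff_disj)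
qed

lemma dissipated_integrable:
  assumes cont: "continuous_on {t0..} q" and nonneg: "\<And>t. t \<ge> t0 \<Longrightarrow> q t \<ge> 0"
    and "c > 0"
    and dom: "\<And>t. t \<ge> t0 \<Longrightarrow> c * q t \<le> 2 * (r0 - r) * (t powr (2 * r - 1) * \<Phi> t)
      + r0 * (t powr (2 * r - 1) * H t) + \<alpha> / 2 * (t powr r * (norm (z' t))\<^sup>2)"
  shows "set_integrable lborel {t0..} q"
proof -
  obtain T where T: "damping_dominates T" using damping_dominates_eventually by blast
  obtain D where D: "\<And>t. t \<ge> T \<Longrightarrow> (energy has_real_derivative D t) (at t)"
    "\<And>t. t \<ge> T \<Longrightarrow>
      D t \<le> - 2 * (r0 - r) * (t powr (2 * r - 1) * \<Phi> t) - r0 * (t powr (2 * r - 1) * H t)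
        - \<alpha> / 2 * (t powr r * (norm (z' t))\<^sup>2)"
    using energy_dissipation[OF T] by metis
  have "t0 \<le> T" using T by (simp add: damping_dominates_def)
  show ?thesis
  proof (rule energy_dissipation_imp_set_integrable[OF cont nonneg \<open>t0 \<le> T\<close> D(1) _ \<open>c > 0\<close>])
    show "D t \<le> - c * q t" if "t \<ge> T" for t
      using D(2)[OF that] dom[of t] that \<open>t0 \<le> T\<close> by (simp add: algebra_simps)
  qed (use energy_nonneg[OF T] in auto)
qed

lemma integrable_dissipation:
  shows "set_integrable lborel {t0..} (\<lambda>t. t powr (2 * r - 1) * \<Phi> t)"
    and "set_integrable lborel {t0..} (\<lambda>t. t powr (2 * r - 1) * H t)"
    and "set_integrable lborel {t0..} (\<lambda>t. t powr r * (norm (z' t))\<^sup>2)"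
proof -
  have \<Phi>_cont: "continuous_on {t0..} \<Phi>"
    using \<Phi>_deriv by (auto simp: continuous_on_eq_continuous_within intro: DERIV_continuous)
  have z'_cont: "continuous_on {t0..} z'"
    using z'_deriv
    by (auto simp: continuous_on_eq_continuous_within intro: has_vector_derivative_continuous)
  have powr_cont: "continuous_on {t0..} (\<lambda>t. t powr a)" for a :: real
    using t0 by (intro continuous_intros) auto
  have sgn: "0 \<le> 2 * (r0 - r)" "0 \<le> r0" "0 \<le> \<alpha> / 2" using r0 r0_pos \<alpha>_pos by auto
  note nonneg = dissipated_nonneg
  show "set_integrable lborel {t0..} (\<lambda>t. t powr (2 * r - 1) * \<Phi> t)"
    using nonneg sgn r0
    by (intro dissipated_integrable[where c = "2 * (r0 - r)"] continuous_on_mult powr_cont \<Phi>_cont) simp_all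
  show "set_integrable lborel {t0..} (\<lambda>t. t powr (2 * r - 1) * H t)"
    using nonneg sgn r0_pos
    by (intro dissipated_integrable[where c = r0] continuous_on_mult powr_cont H_cont) simp_all
  show "set_integrable lborel {t0..} (\<lambda>t. t powr r * (norm (z' t))\<^sup>2)"
    using nonneg sgn \<alpha>_pos
    by (intro dissipated_integrable[where c = "\<alpha> / 2"] continuous_intros powr_cont z'_cont) simp_all
qed

end

section \<open>The primal-dual dynamical system\<close>

lemma C2_on_ray_derivatives:
  assumes "C2_on_ray t0 x" and "t \<ge> t0"
  shows "(x has_vector_derivative tderiv t0 x t) (at t within {t0..})"
    and "(tderiv t0 x has_vector_derivative tderiv t0 (tderiv t0 x) t) (at t within {t0..})"
  using assms vector_derivative_works
  unfolding C2_on_ray_def differentiable_on_def tderiv_def[of t0 "tderiv t0 x"] tderiv_def[of t0 x t]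
  by auto

context
  fixes f :: "real^'n1 \<Rightarrow> real" and g :: "real^'n2 \<Rightarrow> real"
    and A :: "real^'n1^'m" and B :: "real^'n2^'m" and b :: "real^'m"
    and xs :: "real^'n1" and ys :: "real^'n2" and ls :: "real^'m"
  assumes f: "continuously_differentiable f" "convex_on UNIV f"
    and g: "continuously_differentiable g" "convex_on UNIV g"
    and KKT: "(xs, ys, ls) \<in> KKT_set f g A B b"
begin

definition residual where "residual x y = A *v x + B *v y - b"

definition gap where
  "gap x y = aug_lagrangian f g A B b x y ls - aug_lagrangian f g A B b xs ys ls"

lemma residual_KKT: "residual xs ys = 0"
  and grad_f_KKT: "grad f xs = - (transpose A *v ls)"
  and grad_g_KKT: "grad g ys = - (transpose B *v ls)"
  using KKT by (auto simp: KKT_set_def residual_def)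

lemma residual_linear: "residual x y = A *v (x - xs) + B *v (y - ys)"
  using residual_KKT by (simp add: residual_def matrix_vector_mult_diff_distrib algebra_simps)

lemma gap_eq: "gap x y = f x - f xs + (g y - g ys) + ls \<bullet> residual x y + 1/2 * (norm (residual x y))\<^sup>2"
  using residual_KKT by (simp add: gap_def aug_lagrangian_def residual_def)

text \<open>Convexity puts \<open>f\<close> and \<open>g\<close> above their tangents at the KKT point. The slopes of these
  tangents cancel the multiplier term, and the quadratic penalty remains.\<close>
lemma half_residual_le_gap: "1/2 * (norm (residual x y))\<^sup>2 \<le> gap x y"
proof -
  have "grad f xs \<bullet> (x - xs) + grad g ys \<bullet> (y - ys) = - (ls \<bullet> residual x y)"
    unfolding grad_f_KKT grad_g_KKT residual_linear by (simp add: dot_lmul_matrix inner_add_right)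
  then show ?thesis
    using convex_gradient_inequality[OF f, of xs x] convex_gradient_inequality[OF g, of ys y]
    by (simp add: gap_eq)
qed

text \<open>
  Here \<open>(u, v)\<close> is the extrapolated primal displacement. Its image \<open>A u + B v\<close> is the extrapolated
  residual, so the multiplier \<open>l + d l'\<close> in the primal part of \<open>G\<close> and the
  extrapolated multiplier displacement in the dual part meet the same vector and leave
  only \<open>ls\<close>. The terms with factor \<open>d\<close> then assemble to \<open>d * F'\<close>, where \<open>F'\<close> is the
  derivative of the gap, and convexity handles the rest.
\<close>
lemma gap_along_extrapolation:
  fixes x x' :: "real^'n1" and y y' :: "real^'n2" and l l' :: "real^'m" and d :: real
  defines "G \<equiv> (grad f x + transpose A *v (l + d *\<^sub>R l') + transpose A *v residual x y,
                grad g y + transpose B *v (l + d *\<^sub>R l') + transpose B *v residual x y,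
                - residual (x + d *\<^sub>R x') (y + d *\<^sub>R y'))"
    and "F' \<equiv> x' \<bullet> grad f x + y' \<bullet> grad g y + (ls + residual x y) \<bullet> (A *v x' + B *v y')"
  shows "gap x y + (norm (residual x y))\<^sup>2 / 2 + d * F'
    \<le> ((x - xs, y - ys, l - ls) + d *\<^sub>R (x', y', l')) \<bullet> G"
proof -
  define h k where "h = residual x y" and "k = A *v x' + B *v y'"
  define u v where "u = x - xs + d *\<^sub>R x'" and "v = y - ys + d *\<^sub>R y'"
  have Au_Bv: "A *v u + B *v v = h + d *\<^sub>R k"
    unfolding u_def v_def h_def k_def residual_linear
    by (simp add: matrix_vector_right_distrib matrix_vector_mult_scaleR algebra_simps)
  have res: "residual (x + d *\<^sub>R x') (y + d *\<^sub>R y') = h + d *\<^sub>R k"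
    unfolding Au_Bv[symmetric] residual_linear u_def v_def by (simp add: algebra_simps)
  have "(x - xs, y - ys, l - ls) + d *\<^sub>R (x', y', l') = (u, v, l - ls + d *\<^sub>R l')"
    by (simp add: u_def v_def)
  then have "((x - xs, y - ys, l - ls) + d *\<^sub>R (x', y', l')) \<bullet> G
      = (grad f x + transpose A *v (l + d *\<^sub>R l' + h)) \<bullet> u
        + (grad g y + transpose B *v (l + d *\<^sub>R l' + h)) \<bullet> v
        - (l - ls + d *\<^sub>R l') \<bullet> (h + d *\<^sub>R k)"
    unfolding G_def res h_def[symmetric]
    by (simp only: inner_Pair inner_commute[of u] inner_commute[of v] matrix_vector_right_distrib inner_minus_right)
       (simp add: add.assoc)
  also have "\<dots> = u \<bullet> grad f x + v \<bullet> grad g y + (l + d *\<^sub>R l' + h) \<bullet> (A *v u + B *v v)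
        - (l - ls + d *\<^sub>R l') \<bullet> (h + d *\<^sub>R k)"
    by (simp only: transpose_matrix_vector inner_add_left[of "grad _ _"] dot_lmul_matrix
        inner_add_right[of _ "A *v u"] inner_commute[of "grad _ _"])
  also have "\<dots> = u \<bullet> grad f x + v \<bullet> grad g y + (ls + h) \<bullet> (h + d *\<^sub>R k)"
    unfolding Au_Bv by (simp add: inner_simps algebra_simps)
  also have "\<dots> = (x - xs) \<bullet> grad f x + (y - ys) \<bullet> grad g y + ls \<bullet> h + (norm h)\<^sup>2 + d * F'"
    by (simp add: u_def v_def F'_def h_def[symmetric] k_def[symmetric] inner_simps
        power2_norm_eq_inner algebra_simps)
  finally show ?thesis
    using convex_gradient_inequality[OF f, of x xs] convex_gradient_inequality[OF g, of y ys]
    by (simp add: gap_eq h_def inner_simps inner_commute)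
qed

lemma gap_has_derivative:
  assumes "(x has_vector_derivative x') (at t within S)" and "(y has_vector_derivative y') (at t within S)"
  shows "((\<lambda>t. gap (x t) (y t)) has_real_derivative
    x' \<bullet> grad f (x t) + y' \<bullet> grad g (y t) + (ls + residual (x t) (y t)) \<bullet> (A *v x' + B *v y')) (at t within S)"
proof -
  note dx = assms(1)[unfolded has_vector_derivative_def] and dy = assms(2)[unfolded has_vector_derivative_def]
  have df: "((\<lambda>t. f (x t)) has_derivative (\<lambda>h. (h *\<^sub>R x') \<bullet> grad f (x t))) (at t within S)"
    using dx has_derivative_grad[OF f(1)] by (rule has_derivative_compose)
  have dg: "((\<lambda>t. g (y t)) has_derivative (\<lambda>h. (h *\<^sub>R y') \<bullet> grad g (y t))) (at t within S)"
    using dy has_derivative_grad[OF g(1)] by (rule has_derivative_compose)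
  have dres: "((\<lambda>t. residual (x t) (y t)) has_derivative (\<lambda>h. A *v (h *\<^sub>R x') + B *v (h *\<^sub>R y'))) (at t within S)"
    unfolding residual_def
    by (auto intro!: derivative_eq_intros bounded_linear.has_derivative[OF matrix_vector_mul_bounded_linear] dx dy)
  show ?thesis
    unfolding gap_eq power2_norm_eq_inner has_field_derivative_def
    by (rule derivative_eq_intros df dg dres refl)+
       (simp add: fun_eq_iff matrix_vector_mult_scaleR inner_simps inner_commute algebra_simps)
qed

lemma global_solution_damped_inertial_system:
  assumes t0: "t0 \<ge> 1" and r: "0 < r" "r < 1" and "\<alpha> > 0" and "r0 > r"
    and \<gamma>: "\<forall>t\<ge>t0. \<gamma> t = \<alpha> / t powr r" and \<delta>: "\<forall>t\<ge>t0. \<delta> t = t / (2 * r0)"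
    and sol: "global_solution f g A B b \<gamma> \<delta> t0 x y l"
  shows "\<exists>G \<Phi>'. damped_inertial_system
    (\<lambda>t. (x t - xs, y t - ys, l t - ls)) (\<lambda>t. (tderiv t0 x t, tderiv t0 y t, tderiv t0 l t)) G
    (\<lambda>t. gap (x t) (y t)) \<Phi>' (\<lambda>t. (norm (residual (x t) (y t)))\<^sup>2) t0 r \<alpha> r0"
proof -
  let ?x' = "tderiv t0 x" and ?y' = "tderiv t0 y" and ?l' = "tderiv t0 l"
  define G where "G t =
    (grad f (x t) + transpose A *v (l t + \<delta> t *\<^sub>R ?l' t) + transpose A *v residual (x t) (y t),
     grad g (y t) + transpose B *v (l t + \<delta> t *\<^sub>R ?l' t) + transpose B *v residual (x t) (y t),
     - residual (x t + \<delta> t *\<^sub>R ?x' t) (y t + \<delta> t *\<^sub>R ?y' t))" for t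
  define \<Phi>' where "\<Phi>' t = ?x' t \<bullet> grad f (x t) + ?y' t \<bullet> grad g (y t)
    + (ls + residual (x t) (y t)) \<bullet> (A *v ?x' t + B *v ?y' t)" for t
  have C2: "C2_on_ray t0 x" "C2_on_ray t0 y" "C2_on_ray t0 l"
    using sol by (auto simp: global_solution_def)
  note dx = C2_on_ray_derivatives[OF C2(1)] and dy = C2_on_ray_derivatives[OF C2(2)]
    and dl = C2_on_ray_derivatives[OF C2(3)]
  have "damped_inertial_system
    (\<lambda>t. (x t - xs, y t - ys, l t - ls)) (\<lambda>t. (?x' t, ?y' t, ?l' t)) G
    (\<lambda>t. gap (x t) (y t)) \<Phi>' (\<lambda>t. (norm (residual (x t) (y t)))\<^sup>2) t0 r \<alpha> r0"
  proof
    fix t assume t: "t \<ge> t0"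
    show "((\<lambda>t. (x t - xs, y t - ys, l t - ls)) has_vector_derivative (?x' t, ?y' t, ?l' t)) (at t within {t0..})"
      using dx(1)[OF t] dy(1)[OF t] dl(1)[OF t]
      by (intro has_vector_derivative_Pair) (simp_all add: has_vector_derivative_diff_const)
    have "tderiv t0 ?x' t = - (\<alpha> / t powr r) *\<^sub>R ?x' t - fst (G t)"
      "tderiv t0 ?y' t = - (\<alpha> / t powr r) *\<^sub>R ?y' t - fst (snd (G t))"
      "tderiv t0 ?l' t = - (\<alpha> / t powr r) *\<^sub>R ?l' t - snd (snd (G t))"
      using sol t \<gamma> by (simp_all add: global_solution_def G_def residual_def eq_diff_eq algebra_simps)
    then have "(tderiv t0 ?x' t, tderiv t0 ?y' t, tderiv t0 ?l' t)
        = - (\<alpha> / t powr r) *\<^sub>R (?x' t, ?y' t, ?l' t) - G t"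
      by (simp add: prod_eq_iff)
    then show "((\<lambda>t. (?x' t, ?y' t, ?l' t)) has_vector_derivative
        - (\<alpha> / t powr r) *\<^sub>R (?x' t, ?y' t, ?l' t) - G t) (at t within {t0..})"
      using has_vector_derivative_Pair[OF dx(2)[OF t] has_vector_derivative_Pair[OF dy(2)[OF t] dl(2)[OF t]]]
      by simp
    show "((\<lambda>t. gap (x t) (y t)) has_real_derivative \<Phi>' t) (at t within {t0..})"
      unfolding \<Phi>'_def by (rule gap_has_derivative[OF dx(1)[OF t] dy(1)[OF t]])
    show "0 \<le> gap (x t) (y t)"
      by (rule order_trans[OF _ half_residual_le_gap]) simp
    show "gap (x t) (y t) + (norm (residual (x t) (y t)))\<^sup>2 / 2 + t / (2 * r0) * \<Phi>' t
      \<le> ((x t - xs, y t - ys, l t - ls) + (t / (2 * r0)) *\<^sub>R (?x' t, ?y' t, ?l' t)) \<bullet> G t"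
      unfolding \<Phi>'_def G_def \<delta>[rule_format, OF t] by (rule gap_along_extrapolation)
  next
    have "continuous_on {t0..} x" "continuous_on {t0..} y"
      using C2 by (auto simp: C2_on_ray_def intro: differentiable_imp_continuous_on)
    then show "continuous_on {t0..} (\<lambda>t. (norm (residual (x t) (y t)))\<^sup>2)"
      unfolding residual_def
      by (intro continuous_intros linear_continuous_on_compose[OF _ matrix_vector_mul_linear])
  qed (use assms in auto)
  then show ?thesis by blast
qed

end

theorem theorem3p3:
  fixes f :: "real^'n1 \<Rightarrow> real" and g :: "real^'n2 \<Rightarrow> real"
    and A :: "real^'n1^'m" and B :: "real^'n2^'m" and b :: "real^'m"
    and \<gamma> \<delta> :: "real \<Rightarrow> real"
    and t0 r \<alpha> r0 :: real
    and x :: "real \<Rightarrow> real^'n1" and y :: "real \<Rightarrow> real^'n2" and l :: "real \<Rightarrow> real^'m"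
    and xs :: "real^'n1" and ys :: "real^'n2" and ls :: "real^'m"
  assumes "continuously_differentiable f" and "convex_on UNIV f"
    and "continuously_differentiable g" and "convex_on UNIV g"
    and "t0 \<ge> 1"
    and "0 < r" and "r < 1" and "\<alpha> > 0" and "r0 > r"
    and "\<forall>t\<ge>t0. \<gamma> t = \<alpha> / t powr r"
    and "\<forall>t\<ge>t0. \<delta> t = t / (2 * r0)"
    and "global_solution f g A B b \<gamma> \<delta> t0 x y l"
    and "(xs, ys, ls) \<in> KKT_set f g A B b"
  shows "((\<lambda>t. aug_lagrangian f g A B b (x t) (y t) ls - aug_lagrangian f g A B b xs ys ls)
           \<in> O[at_top](\<lambda>t. t powr (- 2 * r))) \<and>
         ((\<lambda>t. norm (A *v x t + B *v y t - b)) \<in> O[at_top](\<lambda>t. t powr (- r))) \<and>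
         (set_integrable lborel {t0..}
           (\<lambda>t. t powr (2 * r - 1) * (norm (A *v x t + B *v y t - b))\<^sup>2)) \<and>
         (set_integrable lborel {t0..}
           (\<lambda>t. t powr r * ((norm (tderiv t0 x t))\<^sup>2 + (norm (tderiv t0 y t))\<^sup>2
                            + (norm (tderiv t0 l t))\<^sup>2))) \<and>
         (set_integrable lborel {t0..}
           (\<lambda>t. t powr (2 * r - 1) * (aug_lagrangian f g A B b (x t) (y t) ls
                                      - aug_lagrangian f g A B b xs ys ls))) \<and>
         ((\<lambda>t. norm (tderiv t0 x t) + norm (tderiv t0 y t) + norm (tderiv t0 l t))
           \<in> O[at_top](\<lambda>t. t powr (- r)))"
proof -
  let ?x' = "tderiv t0 x" and ?y' = "tderiv t0 y" and ?l' = "tderiv t0 l"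
  define h where "h t = A *v x t + B *v y t - b" for t
  define \<Phi> where "\<Phi> t = aug_lagrangian f g A B b (x t) (y t) ls - aug_lagrangian f g A B b xs ys ls" for t
  note setting = assms(1-4) assms(13)
  obtain G \<Phi>' where "damped_inertial_system
      (\<lambda>t. (x t - xs, y t - ys, l t - ls)) (\<lambda>t. (?x' t, ?y' t, ?l' t)) G
      \<Phi> \<Phi>' (\<lambda>t. (norm (h t))\<^sup>2) t0 r \<alpha> r0"
    using global_solution_damped_inertial_system[OF setting assms(5-12)]
    unfolding gap_def[OF setting] residual_def[OF setting] \<Phi>_def h_def by blast
  then interpret damped_inertial_system
      "\<lambda>t. (x t - xs, y t - ys, l t - ls)" "\<lambda>t. (?x' t, ?y' t, ?l' t)" G
      \<Phi> \<Phi>' "\<lambda>t. (norm (h t))\<^sup>2" t0 r \<alpha> r0 .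
  have h_le_\<Phi>: "1/2 * (norm (h t))\<^sup>2 \<le> \<Phi> t" for t
    using half_residual_le_gap[OF setting, of "x t" "y t"]
    unfolding gap_def[OF setting] residual_def[OF setting] \<Phi>_def h_def .
  obtain T C where T: "t0 < T"
    and C: "\<And>t. t \<ge> T \<Longrightarrow> t powr (2 * r) * \<Phi> t \<le> C"
      "\<And>t. t \<ge> T \<Longrightarrow> t powr r * norm (?x' t, ?y' t, ?l' t) \<le> C"
    using gap_and_velocity_bounds by blast
  have t_pos: "t > 0" if "t \<ge> T" for t
    using that T t0 by simp
  have "\<Phi> \<in> O[at_top](\<lambda>t. t powr (- 2 * r))"
  proof (rule bigoI[where c = C], rule eventually_at_top_linorderI[of T])
    fix t assume t: "T \<le> t"
    then show "norm (\<Phi> t) \<le> C * norm (t powr (- 2 * r))"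
      using C(1)[OF t] t_pos[OF t] \<Phi>_nonneg[of t] T by (simp add: powr_minus field_simps)
  qed
  moreover have "(\<lambda>t. norm (h t)) \<in> O[at_top](\<lambda>t. t powr (- r))"
  proof (rule bigoI[where c = "sqrt (2 * C)"], rule eventually_at_top_linorderI[of T])
    fix t assume t: "T \<le> t"
    have "(t powr r * norm (h t))\<^sup>2 = t powr (2 * r) * (norm (h t))\<^sup>2"
      by (simp add: power_mult_distrib power2_eq_square flip: powr_add)
    also have "\<dots> \<le> t powr (2 * r) * (2 * \<Phi> t)"
      using h_le_\<Phi>[of t] by (intro mult_left_mono) auto
    also have "\<dots> \<le> 2 * C"
      using C(1)[OF t] by simp
    finally have "t powr r * norm (h t) \<le> sqrt (2 * C)"
      by (rule real_le_rsqrt)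
    then show "norm (norm (h t)) \<le> sqrt (2 * C) * norm (t powr (- r))"
      using t_pos[OF t] by (simp add: powr_minus field_simps)
  qed
  moreover have "(\<lambda>t. norm (?x' t) + norm (?y' t) + norm (?l' t)) \<in> O[at_top](\<lambda>t. t powr (- r))"
  proof (rule bigoI[where c = "3 * C"], rule eventually_at_top_linorderI[of T])
    fix t assume t: "T \<le> t"
    have "norm (?x' t) + norm (?y' t) + norm (?l' t) \<le> 3 * norm (?x' t, ?y' t, ?l' t)"
      using norm_fst_le[of "?x' t" "(?y' t, ?l' t)"] norm_snd_le[of "(?y' t, ?l' t)" "?x' t"]
        norm_fst_le[of "?y' t" "?l' t"] norm_snd_le[of "?l' t" "?y' t"] by linarith
    also have "t powr r * \<dots> \<le> 3 * C"
      using C(2)[OF t] by simp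
    finally have "t powr r * (norm (?x' t) + norm (?y' t) + norm (?l' t)) \<le> 3 * C"
      by (simp add: mult_left_mono)
    then show "norm (norm (?x' t) + norm (?y' t) + norm (?l' t)) \<le> 3 * C * norm (t powr (- r))"
      using t_pos[OF t] by (simp add: powr_minus field_simps)
  qed
  moreover have "(norm (?x' t, ?y' t, ?l' t))\<^sup>2 = (norm (?x' t))\<^sup>2 + (norm (?y' t))\<^sup>2 + (norm (?l' t))\<^sup>2" for t
    by (simp add: norm_Pair)
  ultimately show ?thesis
    using integrable_dissipation unfolding \<Phi>_def h_def by simp
qed

end
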